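(* Let $(X,\mathcal B)$ be an uncountable standard Borel space, and let $\mathcal Ap$ be the set of all aperiodic Borel automorphisms of $X$. Then: (1) $\overline{\mathcal Ap}^{\tau_0}=\mathcal Ap\bmod(Ctbl)$, the closure being taken in $(Aut(X,\mathcal B),\tau_0)$. (2) $\mathcal Ap$ is a nowhere dense closed subset of $(Aut(X,\mathcal B),\tau)$.
   Context: $Aut(X,\mathcal B)$ is the group of all one-to-one Borel automorphisms of $X$. $T$ is aperiodic if all its orbits are infinite. $\mathcal Ap\bmod(Ctbl)$ is the set of $T\in Aut(X,\mathcal B)$ that are aperiodic except on an at most countable subset of $X$, i.e. for which the set of $T$-periodic points is at most countable. For $S,T\in Aut(X,\mathcal B)$, $E(S,T)=\{x: Tx\ne Sx\}\cup\{x: T^{-1}x\ne S^{-1}x\}$. The topology $\tau$ has as a base of neighborhoods the sets $U(T;\mu_1,\dots,\mu_n;\varepsilon)=\{S:\mu_j(E(S,T))<\varepsilon,\ j=1,\dots,n\}$, with $T\in Aut(X,\mathcal B)$, $\mu_j$ Borel probability measures on $X$, $\varepsilon>0$; the topology $\tau_0$ has as a base the same sets with all $\mu_j$ continuous (non-atomic) Borel probability measures only. *)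

theory Defs
  imports "HOL-Probability.Probability" "HOL-Combinatorics.Permutations"
begin

(* A measurable space (X, B) is given by space M and sets M; the measure carried by M plays no
   role.  It is standard Borel if B is the Borel sigma-algebra of some Polish topology on X. *)
definition standard_borel :: "'a measure \<Rightarrow> bool" where
  "standard_borel M \<longleftrightarrow>
     (\<exists>\<T>. completely_metrizable_space \<T> \<and> separable_space \<T> \<and> topspace \<T> = space M \<and>
        sets M = sigma_sets (space M) {U. openin \<T> U})"

(* Automorphisms are extended by the identity outside X, so that equality of functions is equality
   of automorphisms and inv T is the inverse automorphism. *)
definition Aut :: "'a measure \<Rightarrow> ('a \<Rightarrow> 'a) set" where
  "Aut M = {T. T permutes space M \<and> T \<in> M \<rightarrow>\<^sub>M M \<and> inv T \<in> M \<rightarrow>\<^sub>M M}"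

definition full_orbit :: "('a \<Rightarrow> 'a) \<Rightarrow> 'a \<Rightarrow> 'a set" where
  "full_orbit T x = (\<Union>n. {(T ^^ n) x, (inv T ^^ n) x})"

definition periodic_points :: "'a measure \<Rightarrow> ('a \<Rightarrow> 'a) \<Rightarrow> 'a set" where
  "periodic_points M T = {x \<in> space M. \<exists>n>0. (T ^^ n) x = x}"

definition Ap :: "'a measure \<Rightarrow> ('a \<Rightarrow> 'a) set" where
  "Ap M = {T \<in> Aut M. \<forall>x\<in>space M. infinite (full_orbit T x)}"

definition Ap_mod_Ctbl :: "'a measure \<Rightarrow> ('a \<Rightarrow> 'a) set" where
  "Ap_mod_Ctbl M = {T \<in> Aut M. countable (periodic_points M T)}"

definition E_set :: "'a measure \<Rightarrow> ('a \<Rightarrow> 'a) \<Rightarrow> ('a \<Rightarrow> 'a) \<Rightarrow> 'a set" where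
  "E_set M S T = {x \<in> space M. T x \<noteq> S x} \<union> {x \<in> space M. inv T x \<noteq> inv S x}"

definition prob_measures :: "'a measure \<Rightarrow> 'a measure set" where
  "prob_measures M = {\<mu>. prob_space \<mu> \<and> sets \<mu> = sets M}"

definition continuous_prob_measures :: "'a measure \<Rightarrow> 'a measure set" where
  "continuous_prob_measures M = {\<mu> \<in> prob_measures M. \<forall>x\<in>space M. measure \<mu> {x} = 0}"

definition U_nbhd ::
  "'a measure \<Rightarrow> ('a \<Rightarrow> 'a) \<Rightarrow> nat \<Rightarrow> (nat \<Rightarrow> 'a measure) \<Rightarrow> real \<Rightarrow> ('a \<Rightarrow> 'a) set" where
  "U_nbhd M T n \<mu> \<epsilon> = {S \<in> Aut M. \<forall>j\<in>{1..n}. measure (\<mu> j) (E_set M S T) < \<epsilon>}"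

(* The generating sets are a base, not merely a subbase:
   E(S, R) is contained in the union of E(S, T) and E(T, R). *)
definition nbhd_topology :: "'a measure \<Rightarrow> 'a measure set \<Rightarrow> ('a \<Rightarrow> 'a) topology" where
  "nbhd_topology M P = topology_generated_by
     {U_nbhd M T n \<mu> \<epsilon> | T n \<mu> \<epsilon>. T \<in> Aut M \<and> n \<ge> 1 \<and> (\<forall>j\<in>{1..n}. \<mu> j \<in> P) \<and> \<epsilon> > 0}"

definition tau :: "'a measure \<Rightarrow> ('a \<Rightarrow> 'a) topology" where
  "tau M = nbhd_topology M (prob_measures M)"

definition tau0 :: "'a measure \<Rightarrow> ('a \<Rightarrow> 'a) topology" where
  "tau0 M = nbhd_topology M (continuous_prob_measures M)"

definition nowhere_dense_in :: "'b topology \<Rightarrow> 'b set \<Rightarrow> bool" where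
  "nowhere_dense_in \<T> A \<longleftrightarrow> A \<subseteq> topspace \<T> \<and> \<T> interior_of (\<T> closure_of A) = {}"

end

theory Submission
  imports Defs
begin

text \<open>
  Both topologies are compared through sequences: if \<open>\<mu> (E (S\<^sub>k, T)) \<rightarrow> 0\<close> for every admissible \<open>\<mu>\<close>,
  then \<open>S\<^sub>k\<close> eventually enters every neighbourhood of \<open>T\<close>.  If \<open>T\<close> has only countably many periodic
  points, then replacing \<open>T\<close> by a \<open>\<int>\<close>-shift on a countable invariant set that contains them gives an aperiodic
  \<open>S\<close> with \<open>E (S, T)\<close> countable, hence null for continuous measures.  If \<open>T\<close> is aperiodic, then turning
  the point \<open>T\<^bsup>k+1\<^esup> x\<close> into a fixed point changes \<open>T\<close> only around that point, and the mass there
  tends to 0.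

  Conversely, if \<open>\<mu>\<close> is concentrated on \<open>{x. T\<^sup>n x = x}\<close>, then every \<open>S\<close> close to \<open>T\<close> for the \<open>n\<close> images of
  \<open>\<mu>\<close> under \<open>T\<^sup>0, \<dots>, T\<^bsup>n-1\<^esup>\<close> agrees with \<open>T\<close> along some \<open>T\<close>-cycle and so has a periodic point.  A Dirac
  measure serves for \<open>\<tau>\<close>.  For \<open>\<tau>\<^sub>0\<close> one needs a continuous measure on an uncountable Borel set: Borel sets
  are projections of closed subsets of \<open>X \<times> \<nat>\<^sup>\<nat>\<close>, a Cantor scheme in such a closed set yields an
  injective Borel map from the unit interval into the Borel set, and Lebesgue measure is pushed forward.
\<close>

section \<open>Analytic sets\<close>

lemma second_countable_mtopology:
  assumes "Metric_space X d" and "separable_space (Metric_space.mtopology X d)"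
  shows "second_countable (Metric_space.mtopology X d)"
proof -
  interpret Metric_space X d by fact
  obtain D where D: "countable D" "D \<subseteq> X" "mtopology closure_of D = X"
    using assms(2) unfolding separable_space_def by auto
  let ?B = "(\<lambda>(y, n). mball y (1 / real (Suc n))) ` (D \<times> (UNIV :: nat set))"
  have "\<exists>V\<in>?B. x \<in> V \<and> V \<subseteq> U" if U: "openin mtopology U" "x \<in> U" for U x
  proof -
    obtain r where r: "r > 0" "mball x r \<subseteq> U" and x: "x \<in> X"
      using U unfolding openin_mtopology by blast
    \<comment> \<open>Half of \<open>r\<close>: a ball of this radius that contains \<open>x\<close>
      and is centred at a point \<open>y\<close> of \<open>D\<close> stays within \<open>r\<close>
      of \<open>x\<close>.\<close>
    obtain n where n: "1 / real (Suc n) < r / 2"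
      using nat_approx_posE[of "r / 2"] r by (metis half_gt_zero_iff)
    have "x \<in> mtopology closure_of D"
      using D x by simp
    then have "\<forall>r>0. \<exists>y\<in>D. y \<in> mball x r"
      unfolding metric_closure_of by blast
    moreover have "1 / real (Suc n) > 0"
      by simp
    ultimately obtain y where y: "y \<in> D" "y \<in> mball x (1 / real (Suc n))"
      by blast
    have "x \<in> mball y (1 / real (Suc n))"
      using y by (simp add: commute)
    moreover have "mball y (1 / real (Suc n)) \<subseteq> mball x r"
    proof
      fix z assume z: "z \<in> mball y (1 / real (Suc n))"
      have "d x z \<le> d x y + d y z"
        using triangle x y z by simp
      then show "z \<in> mball x r"
        using x y z n by simp
    qed
    ultimately show ?thesis
      using y(1) r(2) by blast
  qed
  moreover have "countable ?B"
    using D by auto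
  ultimately show ?thesis
    unfolding second_countable_def by (intro exI[of _ ?B]) auto
qed

lemma second_countableE:
  assumes "second_countable X"
  obtains \<B> where "countable \<B>" "\<And>V. V \<in> \<B> \<Longrightarrow> openin X V"
    "\<And>U x. openin X U \<Longrightarrow> x \<in> U \<Longrightarrow> \<exists>V\<in>\<B>. x \<in> V \<and> V \<subseteq> U"
proof -
  obtain \<B> where B: "countable \<B> \<and> (\<forall>V\<in>\<B>. openin X V) \<and>
      (\<forall>U x. openin X U \<and> x \<in> U \<longrightarrow> (\<exists>V\<in>\<B>. x \<in> V \<and> V \<subseteq> U))"
    using assms unfolding second_countable_def by (elim exE)
  show thesis
    by (rule that[of \<B>]) (simp_all add: B)
qed

lemma second_countable_prod_topology:
  assumes "second_countable X" and "second_countable Y"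
  shows "second_countable (prod_topology X Y)"
proof -
  obtain \<B> where \<B>: "countable \<B>" "\<And>V. V \<in> \<B> \<Longrightarrow> openin X V"
    "\<And>U x. openin X U \<Longrightarrow> x \<in> U \<Longrightarrow> \<exists>V\<in>\<B>. x \<in> V \<and> V \<subseteq> U"
    using second_countableE[OF assms(1)] by metis
  obtain \<C> where \<C>: "countable \<C>" "\<And>V. V \<in> \<C> \<Longrightarrow> openin Y V"
    "\<And>U x. openin Y U \<Longrightarrow> x \<in> U \<Longrightarrow> \<exists>V\<in>\<C>. x \<in> V \<and> V \<subseteq> U"
    using second_countableE[OF assms(2)] by metis
  let ?B = "(\<lambda>(U, V). U \<times> V) ` (\<B> \<times> \<C>)"
  have "\<exists>V\<in>?B. x \<in> V \<and> V \<subseteq> U" if U: "openin (prod_topology X Y) U" "x \<in> U" for U x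
  proof -
    obtain a b where x: "x = (a, b)" by force
    obtain V W where VW: "openin X V" "openin Y W" "a \<in> V" "b \<in> W" "V \<times> W \<subseteq> U"
      using U(1)[unfolded openin_prod_topology_alt, rule_format, of a b] U(2) x by auto
    obtain V' where V': "V' \<in> \<B>" "a \<in> V'" "V' \<subseteq> V"
      using \<B>(3)[OF VW(1,3)] by metis
    obtain W' where W': "W' \<in> \<C>" "b \<in> W'" "W' \<subseteq> W"
      using \<C>(3)[OF VW(2,4)] by metis
    have "V' \<times> W' \<in> ?B"
      using imageI[of "(V', W')" "\<B> \<times> \<C>" "\<lambda>(U, V). U \<times> V"] V' W' by simp
    moreover have "x \<in> V' \<times> W'" "V' \<times> W' \<subseteq> U"
      using V' W' VW x by auto
    ultimately show ?thesis by blast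
  qed
  moreover have "countable ?B"
    using \<B> \<C> by auto
  ultimately show ?thesis
    unfolding second_countable_def using \<B>(2) \<C>(2)
    by (intro exI[of _ ?B]) (auto simp: openin_prod_Times_iff)
qed

lemma second_countable_euclidean:
  "second_countable (euclidean :: 'a::second_countable_topology topology)"
proof -
  obtain B :: "'a set set" where B: "countable B" "topological_basis B"
    using ex_countable_basis by blast
  have "\<exists>V\<in>B. x \<in> V \<and> V \<subseteq> U" if "open U" "x \<in> U" for U x
    using topological_basisE[OF B(2) that] by metis
  with B topological_basis_open[OF B(2)] show ?thesis
    unfolding second_countable_def by (intro exI[of _ B]) (simp flip: open_openin)
qed

text \<open>The Baire space is a countable product of discrete spaces. Its completeness is what
  later gives nested closed sets in the product with \<open>X\<close> a common point.\<close>

lemma completely_metrizable_space_baire: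
  "completely_metrizable_space (euclidean :: (nat \<Rightarrow> nat) topology)"
proof -
  have "(euclidean :: nat topology) = discrete_topology UNIV"
    by (simp add: topology_eq discrete_topology_class.open_discrete)
  then have "completely_metrizable_space (product_topology (\<lambda>_::nat. euclidean :: nat topology) UNIV)"
    by (simp add: completely_metrizable_space_product_topology completely_metrizable_space_discrete_topology)
  then show ?thesis
    by (simp add: euclidean_product_topology)
qed

text \<open>Analytic sets are presented through a closed set above them rather than as continuous
  images of the Baire space: the empty set is no exception, witness sequences can be recoded by
  continuous maps, and the closed set is where the Cantor scheme will live.\<close>

definition analytic_in :: "'a topology \<Rightarrow> 'a set \<Rightarrow> bool" where
  "analytic_in X A \<longleftrightarrow>
     (\<exists>C. closedin (prod_topology X (euclidean :: (nat \<Rightarrow> nat) topology)) C \<and> A = fst ` C)"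

lemma closed_imp_analytic_in:
  assumes "closedin X A"
  shows "analytic_in X A"
proof -
  have "closedin (prod_topology X (euclidean :: (nat \<Rightarrow> nat) topology)) (A \<times> UNIV)"
    using assms by (simp add: closedin_prod_Times_iff)
  moreover have "A = fst ` (A \<times> (UNIV :: (nat \<Rightarrow> nat) set))"
    by simp
  ultimately show ?thesis
    unfolding analytic_in_def by blast
qed

text \<open>Selecting coordinates is continuous. Taking \<open>Suc\<close> for \<open>\<rho>\<close>
  drops the first entry of a sequence; taking \<open>k \<mapsto> prod_encode (n, k)\<close> extracts
  row \<open>n\<close> of an array coded in it.\<close>

lemma closedin_preimage_reindex:
  fixes C :: "('a \<times> (nat \<Rightarrow> nat)) set" and \<rho> :: "nat \<Rightarrow> nat"
  assumes "closedin (prod_topology X euclidean) C"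
  shows "closedin (prod_topology X euclidean)
    {z \<in> topspace X \<times> UNIV. (fst z, \<lambda>k. snd z (\<rho> k)) \<in> C}"
proof -
  have c: "continuous_map euclidean euclidean (\<lambda>\<sigma> :: nat \<Rightarrow> nat. \<lambda>k. \<sigma> (\<rho> k))"
    by (auto intro!: continuous_intros continuous_on_coordinatewise_then_product)
  have "continuous_map (prod_topology X euclidean) (prod_topology X euclidean)
      (\<lambda>z. (fst z, (\<lambda>\<sigma> :: nat \<Rightarrow> nat. \<lambda>k. \<sigma> (\<rho> k)) (snd z)))"
    by (intro continuous_map_pairedI continuous_map_fst
        continuous_map_compose[OF continuous_map_snd c, unfolded o_def])
  from closedin_continuous_map_preimage[OF this assms] show ?thesis
    by simp
qed

lemma analytic_in_UN:
  assumes "\<And>n::nat. analytic_in X (A n)"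
  shows "analytic_in X (\<Union>n. A n)"
proof -
  let ?Z = "prod_topology X (euclidean :: (nat \<Rightarrow> nat) topology)"
  obtain C where C: "\<And>n. closedin ?Z (C n)" "\<And>n. A n = fst ` C n"
    using assms unfolding analytic_in_def by metis
  \<comment> \<open>Entry 0 of the sequence says which \<open>A n\<close> is meant, and the tail is
    the witness. \<open>D n\<close> is an implication, namely that the tail works for
    \<open>C n\<close> if entry 0 is \<open>n\<close>; thus the union becomes the projection of an
    intersection of closed sets.\<close>
  define D where "D n = {z \<in> topspace X \<times> UNIV. snd z 0 \<noteq> n} \<union>
    {z \<in> topspace X \<times> UNIV. (fst z, \<lambda>k. snd z (Suc k)) \<in> C n}" for n
  have sub: "C n \<subseteq> topspace X \<times> UNIV" for n
    using closedin_subset[OF C(1)[of n]] by simp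
  have "closedin ?Z {z \<in> topspace X \<times> UNIV. snd z 0 \<noteq> n}" for n
  proof -
    have "continuous_map euclidean euclidean (\<lambda>\<sigma> :: nat \<Rightarrow> nat. \<sigma> 0)"
      by (auto intro!: continuous_intros)
    then have "continuous_map ?Z euclidean (\<lambda>z. snd z 0)"
      using continuous_map_compose[OF continuous_map_snd, unfolded o_def] by blast
    moreover have "closedin euclidean (- {n})"
      by (simp add: discrete_topology_class.open_discrete closed_open)
    ultimately have "closedin ?Z {z \<in> topspace ?Z. snd z 0 \<in> - {n}}"
      by (rule closedin_continuous_map_preimage)
    then show ?thesis by simp
  qed
  then have "closedin ?Z (D n)" for n
    unfolding D_def by (intro closedin_Un closedin_preimage_reindex[OF C(1)])
  then have "closedin ?Z (\<Inter>n. D n)"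
    by blast
  moreover have "(\<Union>n. A n) = fst ` (\<Inter>n. D n)"
  proof (intro equalityI subsetI)
    fix x assume "x \<in> (\<Union>n. A n)"
    then obtain n \<sigma> where n: "(x, \<sigma>) \<in> C n"
      using C(2) by auto
    then have "(x, case_nat n \<sigma>) \<in> (\<Inter>n. D n)"
      using sub unfolding D_def by auto
    then show "x \<in> fst ` (\<Inter>n. D n)"
      by force
  next
    fix x assume "x \<in> fst ` (\<Inter>n. D n)"
    then obtain z where "z \<in> (\<Inter>n. D n)" "x = fst z"
      by (elim imageE)
    then have z: "(x, snd z) \<in> D n" for n
      by simp
    have "(x, \<lambda>k. snd z (Suc k)) \<in> C (snd z 0)"
      using z[of "snd z 0"] unfolding D_def by auto
    then show "x \<in> (\<Union>n. A n)"
      using C(2) by force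
  qed
  ultimately show ?thesis
    unfolding analytic_in_def by blast
qed

lemma analytic_in_INT:
  assumes "\<And>n::nat. analytic_in X (A n)"
  shows "analytic_in X (\<Inter>n. A n)"
proof -
  let ?Z = "prod_topology X (euclidean :: (nat \<Rightarrow> nat) topology)"
  obtain C where C: "\<And>n. closedin ?Z (C n)" "\<And>n. A n = fst ` C n"
    using assms unfolding analytic_in_def by metis
  \<comment> \<open>One sequence codes witnesses for all \<open>n\<close> at once, as the rows of an
    array.\<close>
  define D where "D n = {z \<in> topspace X \<times> UNIV. (fst z, \<lambda>k. snd z (prod_encode (n, k))) \<in> C n}" for n
  have sub: "C n \<subseteq> topspace X \<times> UNIV" for n
    using closedin_subset[OF C(1)[of n]] by simp
  have "closedin ?Z (D n)" for n
    unfolding D_def by (intro closedin_preimage_reindex[OF C(1)])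
  then have "closedin ?Z (\<Inter>n. D n)"
    by blast
  moreover have "(\<Inter>n. A n) = fst ` (\<Inter>n. D n)"
  proof (intro equalityI subsetI)
    fix x assume "x \<in> (\<Inter>n. A n)"
    then have "\<forall>n. \<exists>\<sigma>. (x, \<sigma>) \<in> C n"
      using C(2) by fastforce
    then obtain s where s: "\<And>n. (x, s n) \<in> C n"
      by metis
    have "(x, \<lambda>m. s (fst (prod_decode m)) (snd (prod_decode m))) \<in> (\<Inter>n. D n)"
      using sub s unfolding D_def by auto
    then show "x \<in> fst ` (\<Inter>n. D n)"
      by force
  next
    fix x assume "x \<in> fst ` (\<Inter>n. D n)"
    then obtain z where "z \<in> (\<Inter>n. D n)" "x = fst z"
      by (elim imageE)
    then have z: "(x, snd z) \<in> D n" for n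
      by simp
    have "(x, \<lambda>k. snd z (prod_encode (n, k))) \<in> C n" for n
      using z[of n] unfolding D_def by auto
    then have "x \<in> A n" for n
      using C(2)[of n] by force
    then show "x \<in> (\<Inter>n. A n)"
      by blast
  qed
  ultimately show ?thesis
    unfolding analytic_in_def by blast
qed

lemma open_imp_analytic_in:
  assumes "metrizable_space X" and "openin X U"
  shows "analytic_in X U"
proof -
  obtain C :: "nat \<Rightarrow> 'a set" where "\<And>n. closedin X (C n)" "(\<Union>n. C n) = U"
    using open_imp_fsigma_in[OF assms] unfolding fsigma_in_ascending by blast
  then show ?thesis
    using analytic_in_UN[of X C] closed_imp_analytic_in by blast
qed

lemma Borel_imp_analytic_in:
  assumes X: "metrizable_space X" and A: "A \<in> sigma_sets (topspace X) {U. openin X U}"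
  shows "analytic_in X A"
proof -
  \<comment> \<open>Analyticity alone is not preserved by complements, so the induction carries both
    sets: complementation swaps the two claims, and a union needs an intersection for its
    complement.\<close>
  have "analytic_in X A \<and> analytic_in X (topspace X - A)"
    using A
  proof induction
    case (Basic U)
    then show ?case
      using open_imp_analytic_in[OF X] closed_imp_analytic_in by blast
  next
    case Empty
    show ?case
      by (simp add: closed_imp_analytic_in)
  next
    case (Compl A)
    then have "A \<subseteq> topspace X"
      using sigma_sets_into_sp[of "{U. openin X U}" "topspace X" A] openin_subset by blast
    then show ?case
      using Compl by (simp add: double_diff)
  next
    case (Union A)
    moreover have "topspace X - (\<Union>n. A n) = (\<Inter>n. topspace X - A n)"
      by blast
    ultimately show ?case
      using analytic_in_UN[of X A] analytic_in_INT[of X "\<lambda>n. topspace X - A n"] by simp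
  qed
  then show ?thesis ..
qed

section \<open>Cantor schemes and continuous measures\<close>

text \<open>Each point of \<open>Y\<close> that is not a condensation point lies in a basic open set
  meeting \<open>Y\<close> in a countable set, and there are only countably many basic sets.\<close>

lemma countable_noncondensation:
  assumes "second_countable Z" and "Y \<subseteq> topspace Z"
  shows "countable {y \<in> Y. \<exists>U. openin Z U \<and> y \<in> U \<and> countable (U \<inter> Y)}"
proof -
  obtain \<B> where \<B>: "countable \<B>" "\<And>V. V \<in> \<B> \<Longrightarrow> openin Z V"
    "\<And>U x. openin Z U \<Longrightarrow> x \<in> U \<Longrightarrow> \<exists>V\<in>\<B>. x \<in> V \<and> V \<subseteq> U"
    using second_countableE[OF assms(1)] by metis
  have "{y \<in> Y. \<exists>U. openin Z U \<and> y \<in> U \<and> countable (U \<inter> Y)}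
      \<subseteq> (\<Union>V \<in> {V \<in> \<B>. countable (V \<inter> Y)}. V \<inter> Y)"
  proof
    fix y assume "y \<in> {y \<in> Y. \<exists>U. openin Z U \<and> y \<in> U \<and> countable (U \<inter> Y)}"
    then obtain U where U: "y \<in> Y" "openin Z U" "y \<in> U" "countable (U \<inter> Y)"
      by blast
    then obtain V where "V \<in> \<B>" "y \<in> V" "V \<subseteq> U"
      using \<B>(3) by meson
    moreover have "countable (V \<inter> Y)"
      using U(4) \<open>V \<subseteq> U\<close> by (meson Int_mono countable_subset subset_refl)
    ultimately show "y \<in> (\<Union>V \<in> {V \<in> \<B>. countable (V \<inter> Y)}. V \<inter> Y)"
      using U(1) by blast
  qed
  moreover have "countable (\<Union>V \<in> {V \<in> \<B>. countable (V \<inter> Y)}. V \<inter> Y)"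
    using \<B>(1) by (intro countable_UN) auto
  ultimately show ?thesis
    by (rule countable_subset)
qed

context Metric_space
begin

text \<open>One branching of the Cantor scheme. Two condensation points of
  \<open>K \<inter> Y\<close> have different images by injectivity on \<open>Y\<close>; small closed
  balls around them keep uncountably many points of \<open>Y\<close> and map into disjoint open
  sets. Disjointness is asked of the images because \<open>f\<close> need not be injective on
  \<open>K\<close>.\<close>

lemma uncountable_split:
  assumes "second_countable mtopology" and f: "continuous_map mtopology X f" "Hausdorff_space X"
    and inj: "inj_on f Y" and K: "closedin mtopology K" "uncountable (K \<inter> Y)" and "e > 0"
  shows "\<exists>L R. (closedin mtopology L \<and> uncountable (L \<inter> Y)) \<and> (closedin mtopology R \<and> uncountable (R \<inter> Y)) \<and>
    L \<subseteq> K \<and> R \<subseteq> K \<and> (\<exists>a. L \<subseteq> mcball a e) \<and> (\<exists>a. R \<subseteq> mcball a e) \<and> f ` L \<inter> f ` R = {}"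
proof -
  have KM: "K \<subseteq> M"
    using closedin_subset[OF K(1)] by simp
  define N where "N = {y \<in> K \<inter> Y. \<exists>U. openin mtopology U \<and> y \<in> U \<and> countable (U \<inter> (K \<inter> Y))}"
  have "countable N"
    unfolding N_def using KM by (intro countable_noncondensation assms(1)) auto
  then have unc: "uncountable (K \<inter> Y - N)"
    using K(2) by (rule uncountable_minus_countable[rotated])
  then obtain y0 where y0: "y0 \<in> K \<inter> Y - N"
    by (metis countable_empty ex_in_conv)
  have "uncountable (K \<inter> Y - N - {y0})"
    using unc by (rule uncountable_minus_countable) (rule countable_finite, simp)
  then have "K \<inter> Y - N - {y0} \<noteq> {}"
    using countable_empty by metis
  then obtain y1 where y1: "y1 \<in> K \<inter> Y - N" "y1 \<noteq> y0"
    by blast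
  have "f y0 \<noteq> f y1"
    using inj y0 y1 by (auto simp: inj_on_def)
  moreover have "f y0 \<in> topspace X" "f y1 \<in> topspace X"
    using f(1) y0 y1 KM by (auto simp: continuous_map_def)
  ultimately obtain U0 U1 where U: "openin X U0" "openin X U1" "f y0 \<in> U0" "f y1 \<in> U1" "disjnt U0 U1"
    using f(2) unfolding Hausdorff_space_def by metis
  have *: "\<exists>L. closedin mtopology L \<and> uncountable (L \<inter> Y) \<and> L \<subseteq> K \<and> (\<exists>a. L \<subseteq> mcball a e) \<and> f ` L \<subseteq> U"
    if y: "y \<in> K \<inter> Y - N" and U: "openin X U" "f y \<in> U" for y U
  proof -
    have "openin mtopology {x \<in> M. f x \<in> U}"
      using openin_continuous_map_preimage[OF f(1) U(1)] by simp
    then obtain r where r: "r > 0" "mcball y r \<subseteq> {x \<in> M. f x \<in> U}"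
      unfolding openin_mtopology_mcball using y U(2) KM by blast
    \<comment> \<open>The bound \<open>r\<close> keeps the image in \<open>U\<close>, the bound
      \<open>e\<close> keeps the piece small. The open ball of the same radius already holds
      uncountably many points, since \<open>y\<close> is a condensation point.\<close>
    let ?L = "K \<inter> mcball y (min r e)"
    have "uncountable (mball y (min r e) \<inter> (K \<inter> Y))"
      using y r(1) \<open>e > 0\<close> KM openin_mball[of y "min r e"] centre_in_mball_iff[of y "min r e"]
      unfolding N_def by auto
    moreover have "mball y (min r e) \<inter> (K \<inter> Y) \<subseteq> ?L \<inter> Y"
      using mball_subset_mcball by blast
    ultimately have "uncountable (?L \<inter> Y)"
      using countable_subset by blast
    moreover have "closedin mtopology ?L"
      using K(1) by (intro closedin_Int closedin_mcball)
    moreover have "?L \<subseteq> mcball y e"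
      using mcball_subset_concentric[of "min r e" e y] by auto
    moreover have "f ` ?L \<subseteq> U"
      using r(2) mcball_subset_concentric[of "min r e" r y] by auto
    ultimately show ?thesis
      by blast
  qed
  obtain L where L: "closedin mtopology L" "uncountable (L \<inter> Y)" "L \<subseteq> K"
      "\<exists>a. L \<subseteq> mcball a e" "f ` L \<subseteq> U0"
    using *[OF y0 U(1,3)] by metis
  obtain R where R: "closedin mtopology R" "uncountable (R \<inter> Y)" "R \<subseteq> K"
      "\<exists>a. R \<subseteq> mcball a e" "f ` R \<subseteq> U1"
    using *[OF y1(1) U(2,4)] by metis
  have "U0 \<inter> U1 = {}"
    using U(5) by (simp add: disjnt_def)
  with L(5) R(5) have "f ` L \<inter> f ` R = {}"
    by blast
  with L(1-4) R(1-4) show ?thesis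
    by - (intro exI[of _ L] exI[of _ R] conjI; assumption)
qed

text \<open>
  Node \<open>k < 2 ^ n\<close> of level \<open>n\<close> has the children \<open>2 * k\<close> and \<open>2 * k + 1\<close>, so that the branch of a real
  \<open>x \<in> {0..<1}\<close> runs through the nodes \<open>\<lfloor>2 ^ n * x\<rfloor>\<close>.
\<close>

lemma Cantor_scheme_exists:
  assumes Z: "second_countable mtopology" and f: "continuous_map mtopology X f" "Hausdorff_space X"
    and inj: "inj_on f Y" and C: "closedin mtopology C" "Y \<subseteq> C" "uncountable Y"
  obtains K :: "nat \<Rightarrow> nat \<Rightarrow> 'a set"
  where "\<And>n k. closedin mtopology (K n k)" "\<And>n k. K n k \<noteq> {}" "\<And>n k. K n k \<subseteq> C"
    "\<And>n k. K (Suc n) k \<subseteq> K n (k div 2)"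
    "\<And>n k. \<exists>a. K (Suc n) k \<subseteq> mcball a (1 / real (Suc n))"
    "\<And>n k l. k < 2 ^ n \<Longrightarrow> l < 2 ^ n \<Longrightarrow> k \<noteq> l \<Longrightarrow> f ` K n k \<inter> f ` K n l = {}"
proof -
  \<comment> \<open>The invariant of all nodes: closed, and still rich enough to be split
    again.\<close>
  define P where "P K \<longleftrightarrow> closedin mtopology K \<and> uncountable (K \<inter> Y)" for K
  have "\<forall>K n. \<exists>L R. P K \<longrightarrow> P L \<and> P R \<and> L \<subseteq> K \<and> R \<subseteq> K \<and>
    (\<exists>a. L \<subseteq> mcball a (1 / real (Suc n))) \<and> (\<exists>a. R \<subseteq> mcball a (1 / real (Suc n))) \<and> f ` L \<inter> f ` R = {}"
    using uncountable_split[OF Z f inj] unfolding P_def by (metis of_nat_0_less_iff zero_less_Suc zero_less_divide_1_iff)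
  then obtain L R where LR: "\<And>K n. P K \<Longrightarrow> P (L K n) \<and> P (R K n) \<and> L K n \<subseteq> K \<and> R K n \<subseteq> K \<and>
    (\<exists>a. L K n \<subseteq> mcball a (1 / real (Suc n))) \<and> (\<exists>a. R K n \<subseteq> mcball a (1 / real (Suc n))) \<and>
    f ` L K n \<inter> f ` R K n = {}"
    by metis
  \<comment> \<open>Level 0 is \<open>C\<close> for every index; below it the parity of
    \<open>k\<close> selects the left or right part of the parent \<open>k div 2\<close>. Indices
    from \<open>2 ^ n\<close> on repeat the nodes before them, so disjointness concerns only smaller
    ones.\<close>
  define K :: "nat \<Rightarrow> nat \<Rightarrow> 'a set" where "K = rec_nat (\<lambda>_. C) (\<lambda>n S k. if even k then L (S (k div 2)) n else R (S (k div 2)) n)"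
  have K0: "K 0 k = C" and KSuc: "K (Suc n) k = (if even k then L (K n (k div 2)) n else R (K n (k div 2)) n)" for n k
    by (simp_all add: K_def)
  have P: "P (K n k)" for n k
  proof (induction n arbitrary: k)
    case 0
    then show ?case using C by (simp add: K0 P_def Int_absorb1)
  qed (use LR in \<open>simp add: KSuc\<close>)
  have sub: "K (Suc n) k \<subseteq> K n (k div 2)" for n k
    using LR[OF P] by (simp add: KSuc)
  have disj: "f ` K n k \<inter> f ` K n l = {}" if "k < 2 ^ n" "l < 2 ^ n" "k \<noteq> l" for n k l
    using that
  proof (induction n arbitrary: k l)
    case (Suc n)
    show ?case
    proof (cases "k div 2 = l div 2")
      case True
      then have "even k \<noteq> even l"
        using Suc.prems(3) by (metis even_two_times_div_two odd_two_times_div_two_succ)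
      then show ?thesis
        using LR[OF P, of n "l div 2" n] True by (auto simp: KSuc)
    next
      case False
      have "f ` K n (k div 2) \<inter> f ` K n (l div 2) = {}"
        using Suc False by (intro Suc.IH) auto
      then show ?thesis
        using sub[of n k] sub[of n l] by blast
    qed
  qed simp
  show ?thesis
  proof
    show "closedin mtopology (K n k)" "K n k \<noteq> {}" for n k
      using P[of n k] by (auto simp: P_def)
    show "K n k \<subseteq> C" for n k
    proof (induction n arbitrary: k)
      case (Suc n)
      then show ?case using sub by blast
    qed (simp add: K0)
    show "\<exists>a. K (Suc n) k \<subseteq> mcball a (1 / real (Suc n))" for n k
      using LR[OF P] by (simp add: KSuc)
    show "K (Suc n) k \<subseteq> K n (k div 2)" for n k
      by (fact sub)
    show "f ` K n k \<inter> f ` K n l = {}" if "k < 2 ^ n" "l < 2 ^ n" "k \<noteq> l" for n k l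
      using that by (fact disj)
  qed
qed

end

section \<open>Dyadic approximations of reals in \<open>{0..<1}\<close>\<close>

lemma nat_floor_power2_Suc_div2: "nat \<lfloor>2 ^ Suc n * x\<rfloor> div 2 = nat \<lfloor>2 ^ n * (x::real)\<rfloor>" 
proof -
  have "\<lfloor>2 ^ Suc n * x\<rfloor> div 2 = \<lfloor>2 ^ Suc n * x / 2\<rfloor>"
    using floor_divide_real_eq_div[of 2 "2 ^ Suc n * x"] by simp
  moreover have "nat (\<lfloor>2 ^ Suc n * x\<rfloor> div 2) = nat \<lfloor>2 ^ Suc n * x\<rfloor> div 2"
    using nat_div_distrib'[of 2 "\<lfloor>2 ^ Suc n * x\<rfloor>"] by simp
  ultimately show ?thesis
    by simp
qed

lemma nat_floor_power2_less:
  assumes "x \<in> {0..<1::real}"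
  shows "nat \<lfloor>2 ^ n * x\<rfloor> < 2 ^ n"
proof -
  have "\<lfloor>2 ^ n * x\<rfloor> < 2 ^ n"
    using assms by (simp add: floor_less_iff)
  then show ?thesis
    by (simp add: nat_less_iff assms)
qed

lemma dyadic_separation:
  assumes "x \<in> {0..<1::real}" "y \<in> {0..<1}" "x \<noteq> y"
  shows "\<exists>n. nat \<lfloor>2 ^ n * x\<rfloor> \<noteq> nat \<lfloor>2 ^ n * y\<rfloor>"
proof -
  \<comment> \<open>Scaling by \<open>2 ^ n\<close> moves the two points more than 1 apart, which
    forces different floors.\<close>
  obtain n where "(1/2) ^ n < \<bar>x - y\<bar>"
    using real_arch_pow_inv[of "\<bar>x - y\<bar>" "1/2"] assms(3) by auto
  then have "1 < 2 ^ n * \<bar>x - y\<bar>"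
    by (simp add: field_simps power_divide)
  then have "1 < \<bar>2 ^ n * x - 2 ^ n * y\<bar>"
    by (simp add: abs_mult flip: right_diff_distrib)
  then have "\<lfloor>2 ^ n * x\<rfloor> \<noteq> \<lfloor>2 ^ n * y\<rfloor>"
    by linarith
  moreover have "\<lfloor>2 ^ n * x\<rfloor> \<ge> 0" "\<lfloor>2 ^ n * y\<rfloor> \<ge> 0"
    using assms by auto
  ultimately show ?thesis
    by (metis eq_nat_nat_iff)
qed

text \<open>The nested closed sets along the branch of \<open>x\<close> shrink, so completeness
  gives them a common point \<open>h x\<close>; then \<open>g = f \<circ> h\<close>. The branches of
  two different reals in \<open>{0..<1}\<close> separate at some level into nodes with disjoint
  images, so \<open>g\<close> is injective there.\<close>

lemma (in Metric_space) Cantor_scheme_map: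
  assumes "mcomplete" "second_countable mtopology" "continuous_map mtopology X f" "Hausdorff_space X"
    "inj_on f Y" "closedin mtopology C" "Y \<subseteq> C" "uncountable Y"
  obtains g :: "real \<Rightarrow> 'b" where "inj_on g {0..<1}" "g ` {0..<1} \<subseteq> f ` C"
    "\<And>U. openin X U \<Longrightarrow> {x \<in> {0..<1}. g x \<in> U} \<in> sets borel"
proof -
  obtain K :: "nat \<Rightarrow> nat \<Rightarrow> 'a set"
    where K: "\<And>n k. closedin mtopology (K n k)" "\<And>n k. K n k \<noteq> {}" "\<And>n k. K n k \<subseteq> C"
      "\<And>n k. K (Suc n) k \<subseteq> K n (k div 2)"
      "\<And>n k. \<exists>a. K (Suc n) k \<subseteq> mcball a (1 / real (Suc n))"
      "\<And>n k l. k < 2 ^ n \<Longrightarrow> l < 2 ^ n \<Longrightarrow> k \<noteq> l \<Longrightarrow> f ` K n k \<inter> f ` K n l = {}"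
    using Cantor_scheme_exists[OF assms(2-8)] by metis
  define I :: "nat \<Rightarrow> real \<Rightarrow> nat" where "I n x = nat \<lfloor>2 ^ n * x\<rfloor>" for n x
  have I_Suc: "I (Suc n) x div 2 = I n x" for n x
    unfolding I_def by (rule nat_floor_power2_Suc_div2)
  have I_less: "I n x < 2 ^ n" if "x \<in> {0..<1}" for n x
    unfolding I_def using that by (rule nat_floor_power2_less)
  have "\<exists>z. \<forall>n. z \<in> K n (I n x)" for x
  proof -
    have "decseq (\<lambda>n. K n (I n x))"
      using K(4)[of _ "I (Suc _) x"] by (intro decseq_SucI) (simp add: I_Suc)
    moreover have "\<exists>n a. K n (I n x) \<subseteq> mcball a e" if "e > 0" for e
    proof -
      obtain n where "1 / real (Suc n) < e"
        using nat_approx_posE[OF \<open>e > 0\<close>] by metis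
      moreover obtain a where "K (Suc n) (I (Suc n) x) \<subseteq> mcball a (1 / real (Suc n))"
        using K(5) by metis
      ultimately show ?thesis
        using mcball_subset_concentric[of "1 / real (Suc n)" e a] by (meson less_imp_le order_trans)
    qed
    ultimately have "\<Inter> (range (\<lambda>n. K n (I n x))) \<noteq> {}"
      using mcomplete_nest[THEN iffD1, OF assms(1), rule_format, of "\<lambda>n. K n (I n x)"] K(1,2) by simp
    then show ?thesis
      by blast
  qed
  then obtain h where h: "h x \<in> K n (I n x)" for n x
    by metis
  define g where "g = f \<circ> h"
  have hM: "h x \<in> M" for x
    using h[of x 0] closedin_subset[OF K(1)] by auto
  show thesis
  proof
    show "g ` {0..<1} \<subseteq> f ` C"
      using h K(3) unfolding g_def by fastforce
    show "inj_on g {0..<1}"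
    proof (rule inj_onI, rule ccontr)
      fix x y :: real
      assume xy: "x \<in> {0..<1}" "y \<in> {0..<1}" "g x = g y" "x \<noteq> y"
      then obtain n where "I n x \<noteq> I n y"
        unfolding I_def using dyadic_separation by blast
      then have "f ` K n (I n x) \<inter> f ` K n (I n y) = {}"
        using K(6) I_less xy by blast
      moreover have "g x \<in> f ` K n (I n x)" "g y \<in> f ` K n (I n y)"
        unfolding g_def using h by auto
      ultimately show False
        using xy(3) by auto
    qed
    fix U assume U: "openin X U"
    \<comment> \<open>The nodes at which membership in \<open>U\<close> is already decided. By
      continuity and shrinking, every \<open>x\<close> with \<open>g x \<in> U\<close> passes
      through such a node, so the preimage is a countable union of dyadic intervals.\<close>
    define J where "J = {(n, k). f ` K n k \<subseteq> U}"
    have "\<exists>n. f ` K n (I n x) \<subseteq> U" if "g x \<in> U" for x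
    proof -
      have "openin mtopology {z \<in> M. f z \<in> U}"
        using openin_continuous_map_preimage[OF assms(3) U] by simp
      moreover have "h x \<in> {z \<in> M. f z \<in> U}"
        using that hM by (simp add: g_def)
      ultimately obtain r where r: "r > 0" "mball (h x) r \<subseteq> {z \<in> M. f z \<in> U}"
        unfolding openin_mtopology by blast
      \<comment> \<open>Two points of a closed ball of radius \<open>1 / real (Suc n)\<close> are
        then less than \<open>r\<close> apart, and \<open>h x\<close> is one of the points of the
        node.\<close>
      obtain n where n: "1 / real (Suc n) < r / 2"
        using nat_approx_posE[of "r / 2"] r(1) by (metis half_gt_zero_iff)
      obtain a where a: "K (Suc n) (I (Suc n) x) \<subseteq> mcball a (1 / real (Suc n))"
        using K(5) by metis
      have "K (Suc n) (I (Suc n) x) \<subseteq> mball (h x) r"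
      proof
        fix z assume "z \<in> K (Suc n) (I (Suc n) x)"
        then have "z \<in> mcball a (1 / real (Suc n))" "h x \<in> mcball a (1 / real (Suc n))"
          using a h by blast+
        then show "z \<in> mball (h x) r"
          using triangle[of "h x" a z] commute[of a "h x"] n by simp
      qed
      then have "f ` K (Suc n) (I (Suc n) x) \<subseteq> U"
        using r(2) by blast
      then show ?thesis ..
    qed
    moreover have "g x \<in> U" if "f ` K n (I n x) \<subseteq> U" for n x
      using that h unfolding g_def by auto
    ultimately have "{x \<in> {0..<1}. g x \<in> U} = (\<Union>(n, k)\<in>J. {x \<in> {0..<1}. I n x = k})"
      unfolding J_def by auto
    moreover have "{x \<in> {0..<1}. I n x = k} \<in> sets borel" for n k
      unfolding I_def by measurable
    ultimately show "{x \<in> {0..<1}. g x \<in> U} \<in> sets borel"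
      by (auto intro!: sets.countable_UN')
  qed
qed

section \<open>Continuous measures on uncountable Borel sets\<close>

lemma uncountable_Borel_injection:
  assumes X: "completely_metrizable_space X" "separable_space X"
    and A: "A \<in> sigma_sets (topspace X) {U. openin X U}" "uncountable A"
  obtains g :: "real \<Rightarrow> 'a" where "inj_on g {0..<1}" "g ` {0..<1} \<subseteq> A"
    "\<And>U. openin X U \<Longrightarrow> {x \<in> {0..<1}. g x \<in> U} \<in> sets borel"
proof -
  let ?Z = "prod_topology X (euclidean :: (nat \<Rightarrow> nat) topology)"
  have met: "metrizable_space X"
    using X(1) by (rule completely_metrizable_imp_metrizable_space)
  then obtain M d where "Metric_space M d" "X = Metric_space.mtopology M d"
    unfolding metrizable_space_def by blast
  then have "second_countable X"
    using second_countable_mtopology X(2) by metis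
  then have sc: "second_countable ?Z"
    using second_countable_euclidean by (rule second_countable_prod_topology)
  have "completely_metrizable_space ?Z"
    using X(1) completely_metrizable_space_baire by (simp add: completely_metrizable_space_prod_topology)
  then obtain Z e where Z: "Metric_space Z e" "Metric_space.mcomplete Z e" "?Z = Metric_space.mtopology Z e"
    unfolding completely_metrizable_space_def by blast
  obtain C where C: "closedin ?Z C" "A = fst ` C"
    using Borel_imp_analytic_in[OF met A(1)] unfolding analytic_in_def by blast
  \<comment> \<open>One point of \<open>C\<close> above each point of \<open>A\<close>: the
    projection is injective on \<open>Y\<close>, and \<open>Y\<close> is uncountable with
    \<open>A\<close>. The scheme may pick points of \<open>C\<close> outside \<open>Y\<close>, but
    these still project into \<open>A\<close>.\<close>
  define Y where "Y = inv_into C fst ` A"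
  have inv: "inv_into C fst a \<in> C" "fst (inv_into C fst a) = a" if "a \<in> A" for a
    using that unfolding C(2) by (simp_all only: inv_into_into f_inv_into_f)
  have Y: "Y \<subseteq> C"
    unfolding Y_def using inv(1) by blast
  have fY: "fst ` Y = A"
    unfolding Y_def by (simp add: image_image inv(2))
  have "inj_on fst Y"
    unfolding Y_def by (rule inj_onI) (elim imageE, simp add: inv(2))
  moreover have "uncountable Y"
    using A(2) fY countable_image by metis
  moreover have "Hausdorff_space X"
    using met by (rule metrizable_imp_Hausdorff_space)
  ultimately show thesis
    using Metric_space.Cantor_scheme_map[OF Z(1,2), of X fst Y C] sc C Y that continuous_map_fst[of X "euclidean :: (nat \<Rightarrow> nat) topology"]
    unfolding Z(3) by metis
qed

lemma continuous_prob_measure_exists: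
  assumes "standard_borel M" and A: "A \<in> sets M" "uncountable A"
  obtains \<mu> where "\<mu> \<in> continuous_prob_measures M" "measure \<mu> A = 1"
proof -
  obtain X where X: "completely_metrizable_space X" "separable_space X" "topspace X = space M"
      "sets M = sigma_sets (space M) {U. openin X U}"
    using assms(1) unfolding standard_borel_def by blast
  obtain g :: "real \<Rightarrow> 'a" where g: "inj_on g {0..<1}" "g ` {0..<1} \<subseteq> A"
      "\<And>U. openin X U \<Longrightarrow> {x \<in> {0..<1}. g x \<in> U} \<in> sets borel"
    using uncountable_Borel_injection[OF X(1,2), of A] A X(3,4) by metis
  define N where "N = restrict_space lborel {0..<1::real}"
  have spN: "space N = {0..<1}"
    by (simp add: N_def space_restrict_space)
  have setsN: "S \<in> sets N \<longleftrightarrow> S \<subseteq> {0..<1} \<and> S \<in> sets borel" for S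
    by (simp add: N_def sets_restrict_space_iff)
  have "prob_space N"
    unfolding N_def by (rule prob_space_restrict_space) simp_all
  have AM: "A \<subseteq> space M"
    using A(1) by (rule sets.sets_into_space)
  have gm: "g \<in> N \<rightarrow>\<^sub>M M"
  proof (rule measurable_sigma_sets[OF X(4)])
    show "{U. openin X U} \<subseteq> Pow (space M)"
      using openin_subset X(3) by blast
    show "g \<in> space N \<rightarrow> space M"
      using g(2) AM spN by auto
    fix U assume "U \<in> {U. openin X U}"
    then have "{x \<in> {0..<1}. g x \<in> U} \<in> sets borel"
      by (intro g(3)) simp
    moreover have "g -` U \<inter> space N = {x \<in> {0..<1}. g x \<in> U}"
      unfolding spN by blast
    moreover have "{x \<in> {0..<1}. g x \<in> U} \<subseteq> {0..<1}"
      by blast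
    ultimately show "g -` U \<inter> space N \<in> sets N"
      unfolding setsN by metis
  qed
  interpret N: prob_space N by fact
  \<comment> \<open>Injectivity leaves at most one point in each fibre, which is Lebesgue null. If
    \<open>{x}\<close> is not measurable, its measure is 0 by convention.\<close>
  have "measure (distr N M g) {x} = 0" for x
  proof (cases "{x} \<in> sets M")
    case True
    have "\<exists>y. g -` {x} \<inter> space N \<subseteq> {y}"
    proof (cases "g -` {x} \<inter> space N = {}")
      case False
      then obtain y where "y \<in> g -` {x} \<inter> space N"
        by blast
      then have "g -` {x} \<inter> space N \<subseteq> {y}"
        using g(1) spN by (auto simp: inj_on_def)
      then show ?thesis ..
    qed auto
    then have "g -` {x} \<inter> space N \<in> null_sets lborel"
      by (metis countable_subset countable_insert countable_empty countable_imp_null_set_lborel)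
    then have "emeasure N (g -` {x} \<inter> space N) = 0"
      unfolding N_def by (subst emeasure_restrict_space) (auto simp: space_restrict_space)
    then show ?thesis
      using True gm by (simp add: measure_def emeasure_distr)
  qed (simp add: measure_notin_sets)
  moreover have "measure (distr N M g) A = 1"
  proof -
    have "g -` A \<inter> space N = space N"
      using g(2) spN by auto
    then show ?thesis
      by (simp only: measure_distr[OF gm A(1)] N.prob_space)
  qed
  moreover have "prob_space (distr N M g)"
    using gm by (rule N.prob_space_distr)
  ultimately show thesis
    by (intro that[of "distr N M g"]) (simp_all add: continuous_prob_measures_def prob_measures_def)
qed

section \<open>Automorphisms and neighbourhoods\<close>

lemma standard_borel_second_countable:
  assumes "standard_borel M"
  obtains X where "metrizable_space X" "second_countable X" "topspace X = space M"
    "\<And>U. openin X U \<Longrightarrow> U \<in> sets M"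
proof -
  obtain X where X: "completely_metrizable_space X" "separable_space X" "topspace X = space M"
      "sets M = sigma_sets (space M) {U. openin X U}"
    using assms unfolding standard_borel_def by blast
  have met: "metrizable_space X"
    using X(1) by (rule completely_metrizable_imp_metrizable_space)
  then obtain Y d where "Metric_space Y d" "X = Metric_space.mtopology Y d"
    unfolding metrizable_space_def by blast
  then have "second_countable X"
    using second_countable_mtopology X(2) by metis
  then show thesis
    using that[OF met] X(3,4) by auto
qed

text \<open>Different values are separated by a basic open set that contains the first but not the
  second, so the set is a countable union of differences of preimages.\<close>

lemma sets_neq:
  assumes "standard_borel M" and f: "f \<in> M \<rightarrow>\<^sub>M M" and g: "g \<in> M \<rightarrow>\<^sub>M M"
  shows "{x \<in> space M. f x \<noteq> g x} \<in> sets M"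
proof -
  obtain X where X: "metrizable_space X" "second_countable X" "topspace X = space M"
    "\<And>U. openin X U \<Longrightarrow> U \<in> sets M"
    using standard_borel_second_countable[OF assms(1)] by metis
  obtain \<B> where \<B>: "countable \<B>" "\<And>V. V \<in> \<B> \<Longrightarrow> openin X V"
    "\<And>U x. openin X U \<Longrightarrow> x \<in> U \<Longrightarrow> \<exists>V\<in>\<B>. x \<in> V \<and> V \<subseteq> U"
    using second_countableE[OF X(2)] by metis
  have "\<exists>V\<in>\<B>. f x \<in> V \<and> g x \<notin> V" if x: "x \<in> space M" "f x \<noteq> g x" for x
  proof -
    have "f x \<in> topspace X" "g x \<in> topspace X"
      using x(1) f g X(3) by (auto dest: measurable_space)
    then obtain U V where U: "openin X U" "f x \<in> U" "g x \<in> V" "disjnt U V"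
      using metrizable_imp_Hausdorff_space[OF X(1)] x(2) unfolding Hausdorff_space_def by metis
    then have "g x \<notin> U"
      by (auto simp: disjnt_iff)
    then show ?thesis
      using \<B>(3)[OF U(1,2)] by blast
  qed
  then have "{x \<in> space M. f x \<noteq> g x} = (\<Union>V\<in>\<B>. (f -` V \<inter> space M) - (g -` V \<inter> space M))"
    by auto
  moreover have "(f -` V \<inter> space M) - (g -` V \<inter> space M) \<in> sets M" if "V \<in> \<B>" for V
    using X(4)[OF \<B>(2)[OF that]] f g by (intro sets.Diff measurable_sets)
  then have "(\<Union>V\<in>\<B>. (f -` V \<inter> space M) - (g -` V \<inter> space M)) \<in> sets M"
    using \<B>(1) by (intro sets.countable_UN'')
  ultimately show ?thesis
    by (simp only:)
qed

lemma sets_eq: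
  assumes "standard_borel M" and "f \<in> M \<rightarrow>\<^sub>M M" and "g \<in> M \<rightarrow>\<^sub>M M"
  shows "{x \<in> space M. f x = g x} \<in> sets M"
proof -
  have "{x \<in> space M. f x = g x} = space M - {x \<in> space M. f x \<noteq> g x}"
    by blast
  then show ?thesis
    using sets_neq[OF assms] by simp
qed

lemma singleton_in_sets:
  assumes "standard_borel M" and "x \<in> space M"
  shows "{x} \<in> sets M"
proof -
  have "{y \<in> space M. y = x} \<in> sets M"
    using sets_eq[OF assms(1), of "\<lambda>y. y" "\<lambda>_. x"] assms(2) by simp
  moreover have "{y \<in> space M. y = x} = {x}"
    using assms(2) by blast
  ultimately show ?thesis
    by simp
qed

lemma E_set_in_sets:
  assumes "standard_borel M" "S \<in> Aut M" "T \<in> Aut M"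
  shows "E_set M S T \<in> sets M"
  using assms sets_neq[OF assms(1)] unfolding E_set_def Aut_def by (intro sets.Un) auto

lemma E_set_triangle: "E_set M S R \<subseteq> E_set M S T \<union> E_set M T R"
  by (auto simp: E_set_def)

section \<open>Orbits and periods\<close>

lemma full_orbit_closed:
  assumes T: "bij T" and y: "y \<in> full_orbit T x"
  shows "T y \<in> full_orbit T x" and "inv T y \<in> full_orbit T x"
proof -
  have I: "(T ^^ k) x \<in> full_orbit T x" "(inv T ^^ k) x \<in> full_orbit T x" for k
    unfolding full_orbit_def by blast+
  have inv: "T (inv T z) = z" "inv T (T z) = z" for z
    using T by (simp_all add: bij_is_surj surj_f_inv_f bij_is_inj)
  obtain k where "y = (T ^^ k) x \<or> y = (inv T ^^ k) x"
    using y unfolding full_orbit_def by blast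
  then show "T y \<in> full_orbit T x" "inv T y \<in> full_orbit T x"
    using I[of "Suc k"] I[of 1] I[of "k - 1"] by (cases k; auto simp: inv)+
qed

text \<open>A finite orbit repeats a forward iterate, and injectivity cancels this down to a return
  to \<open>x\<close>. Conversely a return after \<open>n\<close> steps, which \<open>inv T\<close>
  shares, reduces all exponents modulo \<open>n\<close>.\<close>

lemma finite_full_orbit_iff:
  assumes T: "bij T"
  shows "finite (full_orbit T x) \<longleftrightarrow> (\<exists>n>0. (T ^^ n) x = x)"
proof
  assume "finite (full_orbit T x)"
  moreover have "range (\<lambda>n. (T ^^ n) x) \<subseteq> full_orbit T x"
    unfolding full_orbit_def by blast
  ultimately have "\<not> inj (\<lambda>n. (T ^^ n) x)"
    using finite_imageD finite_subset infinite_UNIV_nat by blast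
  then obtain i j where ij: "(T ^^ i) x = (T ^^ j) x" "i < j"
    unfolding inj_def by (metis linorder_neqE_nat)
  have "(T ^^ i) ((T ^^ (j - i)) x) = (T ^^ (i + (j - i))) x"
    by (simp only: funpow_add comp_apply)
  then have "(T ^^ i) ((T ^^ (j - i)) x) = (T ^^ i) x"
    using ij by simp
  then have "(T ^^ (j - i)) x = x"
    using inj_fn[OF bij_is_inj[OF T], of i] by (simp add: inj_eq)
  then show "\<exists>n>0. (T ^^ n) x = x"
    using ij(2) by (metis zero_less_diff)
next
  assume "\<exists>n>0. (T ^^ n) x = x"
  then obtain n where n: "n > 0" "(T ^^ n) x = x"
    by blast
  have "((inv T ^^ n) \<circ> (T ^^ n)) x = x"
    using fn_o_inv_fn_is_id[OF bij_imp_bij_inv[OF T], of n] T by (simp add: inv_inv_eq fun_eq_iff)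
  then have n': "(inv T ^^ n) x = x"
    using n(2) by simp
  have "full_orbit T x \<subseteq> (\<lambda>k. (T ^^ k) x) ` {..<n} \<union> (\<lambda>k. (inv T ^^ k) x) ` {..<n}"
  proof
    fix y assume "y \<in> full_orbit T x"
    then obtain k where "y = (T ^^ k) x \<or> y = (inv T ^^ k) x"
      unfolding full_orbit_def by blast
    then have "y = (T ^^ (k mod n)) x \<or> y = (inv T ^^ (k mod n)) x"
      using funpow_mod_eq[OF n(2), of k] funpow_mod_eq[OF n', of k] by simp
    then show "y \<in> (\<lambda>k. (T ^^ k) x) ` {..<n} \<union> (\<lambda>k. (inv T ^^ k) x) ` {..<n}"
      using n(1) by auto
  qed
  then show "finite (full_orbit T x)"
    by (rule finite_subset) simp
qed

lemma Ap_iff: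
  "T \<in> Ap M \<longleftrightarrow> T \<in> Aut M \<and> (\<forall>x\<in>space M. \<forall>n>0. (T ^^ n) x \<noteq> x)"
proof (cases "T \<in> Aut M")
  case True
  then have "bij T"
    by (auto simp: Aut_def intro: permutes_bij)
  then show ?thesis
    unfolding Ap_def mem_Collect_eq finite_full_orbit_iff[OF \<open>bij T\<close>] by blast
qed (simp add: Ap_def)

section \<open>The topologies generated by classes of measures\<close>

lemma openin_U_nbhd:
  assumes "T \<in> Aut M" "n \<ge> 1" "\<And>j. j \<in> {1..n} \<Longrightarrow> \<mu> j \<in> P" "\<epsilon> > 0"
  shows "openin (nbhd_topology M P) (U_nbhd M T n \<mu> \<epsilon>)"
  unfolding nbhd_topology_def openin_topology_generated_by_iff
  by (rule generate_topology_on.Basis, rule CollectI, intro exI conjI, rule refl) (use assms in auto)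

lemma topspace_nbhd_topology:
  assumes "P \<noteq> {}"
  shows "topspace (nbhd_topology M P) = Aut M"
proof
  show "topspace (nbhd_topology M P) \<subseteq> Aut M"
    unfolding nbhd_topology_def topology_generated_by_topspace U_nbhd_def by blast
  show "Aut M \<subseteq> topspace (nbhd_topology M P)"
  proof
    fix T assume T: "T \<in> Aut M"
    \<comment> \<open>Every generating set involves at least one measure of \<open>P\<close>; with
      one at hand, \<open>T\<close> lies in its own neighbourhood because \<open>E_set M T T\<close>
      is empty.\<close>
    obtain \<mu> where \<mu>: "\<mu> \<in> P"
      using assms by blast
    have "T \<in> U_nbhd M T 1 (\<lambda>_. \<mu>) 1"
      using T by (simp add: U_nbhd_def E_set_def)
    moreover have "openin (nbhd_topology M P) (U_nbhd M T 1 (\<lambda>_. \<mu>) 1)"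
      using T \<mu> by (intro openin_U_nbhd) auto
    ultimately show "T \<in> topspace (nbhd_topology M P)"
      using openin_subset by blast
  qed
qed

text \<open>Intersections and unions respect eventual membership, so only generating sets matter.
  The centre \<open>R\<close> of such a set may differ from \<open>T\<close>, but \<open>T\<close>
  being inside leaves the positive slack
  \<open>\<epsilon> - measure (\<mu> j) (E_set M T R)\<close>, and the distance from
  \<open>S k\<close> to \<open>T\<close> eventually falls below it.\<close>

lemma eventually_in_nbhd_topology:
  assumes M: "standard_borel M" and P: "P \<subseteq> prob_measures M"
    and S: "\<And>k. S k \<in> Aut M" and T: "T \<in> Aut M"
    and lim: "\<And>\<mu>. \<mu> \<in> P \<Longrightarrow> (\<lambda>k. measure \<mu> (E_set M (S k) T)) \<longlonglongrightarrow> 0"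
    and W: "openin (nbhd_topology M P) W" "T \<in> W"
  shows "\<forall>\<^sub>F k in sequentially. S k \<in> W"
proof -
  have "generate_topology_on
      {U_nbhd M T n \<mu> \<epsilon> | T n \<mu> \<epsilon>. T \<in> Aut M \<and> n \<ge> 1 \<and> (\<forall>j\<in>{1..n}. \<mu> j \<in> P) \<and> \<epsilon> > 0} W"
    using W(1) unfolding nbhd_topology_def openin_topology_generated_by_iff .
  then show ?thesis
    using W(2)
  proof induction
    case (Int a b)
    then show ?case
      by (simp add: eventually_conj)
  next
    case (UN K)
    then obtain V where "V \<in> K" "T \<in> V"
      by blast
    then have "\<forall>\<^sub>F k in sequentially. S k \<in> V"
      using UN.IH by blast
    then show ?case
      using \<open>V \<in> K\<close> by (auto elim: eventually_mono)
  next
    case (Basis s)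
    then obtain R n \<mu> \<epsilon> where s: "s = U_nbhd M R n \<mu> \<epsilon>" "R \<in> Aut M" "\<And>j. j \<in> {1..n} \<Longrightarrow> \<mu> j \<in> P"
      by blast
    have "\<forall>\<^sub>F k in sequentially. measure (\<mu> j) (E_set M (S k) R) < \<epsilon>" if j: "j \<in> {1..n}" for j
    proof -
      have \<mu>: "prob_space (\<mu> j)" "sets (\<mu> j) = sets M"
        using s(3)[OF j] P by (auto simp: prob_measures_def)
      interpret prob_space "\<mu> j" by fact
      have le: "prob (E_set M (S k) R) \<le> prob (E_set M (S k) T) + prob (E_set M T R)" for k
      proof -
        have sets: "E_set M (S k) T \<in> events" "E_set M T R \<in> events"
          using E_set_in_sets[OF M] S T s(2) \<mu>(2) by simp_all
        then have "prob (E_set M (S k) R) \<le> prob (E_set M (S k) T \<union> E_set M T R)"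
          by (intro finite_measure_mono E_set_triangle sets.Un)
        also have "\<dots> \<le> prob (E_set M (S k) T) + prob (E_set M T R)"
          using sets by (intro measure_Un_le)
        finally show ?thesis .
      qed
      have "prob (E_set M T R) < \<epsilon>"
        using Basis(2) j unfolding s(1) U_nbhd_def by blast
      then have "\<forall>\<^sub>F k in sequentially. prob (E_set M (S k) T) < \<epsilon> - prob (E_set M T R)"
        using order_tendstoD(2)[OF lim[OF s(3)[OF j]]] by simp
      then show ?thesis
        by eventually_elim (use le in \<open>smt (verit)\<close>)
    qed
    then have "\<forall>\<^sub>F k in sequentially. \<forall>j\<in>{1..n}. measure (\<mu> j) (E_set M (S k) R) < \<epsilon>"
      by (intro eventually_ball_finite) auto
    then show ?case
      unfolding s(1) U_nbhd_def using S by simp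
  qed simp
qed

section \<open>Push-forwards and neighbourhoods of automorphisms with periodic points\<close>

lemma distr_Aut_continuous:
  assumes "\<mu> \<in> continuous_prob_measures M" "T \<in> Aut M" and M: "standard_borel M"
  shows "distr \<mu> M T \<in> continuous_prob_measures M"
proof -
  have \<mu>: "prob_space \<mu>" "sets \<mu> = sets M" "\<And>x. x \<in> space M \<Longrightarrow> measure \<mu> {x} = 0"
    using assms(1) by (auto simp: continuous_prob_measures_def prob_measures_def)
  have T: "T permutes space M" "T \<in> M \<rightarrow>\<^sub>M M"
    using assms(2) by (auto simp: Aut_def)
  have Tm: "T \<in> \<mu> \<rightarrow>\<^sub>M M"
    using T(2) measurable_cong_sets[OF \<mu>(2) refl] by blast
  have "measure (distr \<mu> M T) {x} = 0" if x: "x \<in> space M" for x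
  proof -
    \<comment> \<open>The fibre of a bijection over a point is again a point, hence null.\<close>
    have "T -` {x} \<inter> space \<mu> = {inv T x}"
      using permutes_inverses[OF T(1)] permutes_in_image[OF permutes_inv[OF T(1)]] x sets_eq_imp_space_eq[OF \<mu>(2)]
      by auto
    moreover have "inv T x \<in> space M"
      using permutes_in_image[OF permutes_inv[OF T(1)]] x by simp
    ultimately show ?thesis
      using \<mu>(3) by (simp add: measure_distr[OF Tm singleton_in_sets[OF M x]])
  qed
  then show ?thesis
    using prob_space.prob_space_distr[OF \<mu>(1) Tm] by (simp add: continuous_prob_measures_def prob_measures_def)
qed

lemma distr_Aut_prob:
  assumes "\<mu> \<in> prob_measures M" "T \<in> Aut M"
  shows "distr \<mu> M T \<in> prob_measures M"
proof -
  have \<mu>: "prob_space \<mu>"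
    using assms(1) by (simp add: prob_measures_def)
  have "T \<in> \<mu> \<rightarrow>\<^sub>M M"
    using assms measurable_cong_sets[of \<mu> M M M] unfolding Aut_def prob_measures_def by blast
  from prob_space.prob_space_distr[OF \<mu> this] show ?thesis
    by (simp add: prob_measures_def)
qed

text \<open>Stated for any class \<open>P\<close> stable under push-forward, so that it serves both
  topologies. The images of \<open>\<mu>\<close> control the disagreement of \<open>S\<close> and
  \<open>T\<close> at each of the \<open>n\<close> steps; the errors add up to less than 1, so some
  point that \<open>T\<close> returns after \<open>n\<close> steps meets none of them.\<close>

lemma periodic_nbhd_disjoint_Ap:
  assumes M: "standard_borel M" and P: "P \<subseteq> prob_measures M"
    and push: "\<And>\<mu> T. \<mu> \<in> P \<Longrightarrow> T \<in> Aut M \<Longrightarrow> distr \<mu> M T \<in> P"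
    and T: "T \<in> Aut M" and "n > 0" and \<mu>: "\<mu> \<in> P" "measure \<mu> {x \<in> space M. (T ^^ n) x = x} = 1"
  obtains W where "openin (nbhd_topology M P) W" "T \<in> W" "W \<inter> Ap M = {}"
proof -
  \<comment> \<open>The measures of a neighbourhood are numbered from 1, the exponents run from
    0.\<close>
  define \<nu> where "\<nu> j = distr \<mu> M (T ^^ (j - 1))" for j :: nat
  have Tm: "T \<in> M \<rightarrow>\<^sub>M M"
    using T by (simp add: Aut_def)
  then have Tn: "T ^^ i \<in> M \<rightarrow>\<^sub>M M" for i
    by (rule measurable_compose_n)
  have \<mu>M: "prob_space \<mu>" "sets \<mu> = sets M" "space \<mu> = space M"
    using \<mu>(1) P sets_eq_imp_space_eq[of \<mu> M] by (auto simp: prob_measures_def)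
  have Tn\<mu>: "T ^^ i \<in> \<mu> \<rightarrow>\<^sub>M M" for i
    using Tn measurable_cong_sets[OF \<mu>M(2) refl] by blast
  have "distr \<mu> M (T ^^ i) \<in> P" for i
  proof (induction i)
    case 0
    have "distr \<mu> M (\<lambda>x. x) = \<mu>"
      using \<mu>M(2) by (simp add: distr_id2)
    then show ?case
      using \<mu>(1) by (simp add: id_def)
  next
    case (Suc i)
    have "distr (distr \<mu> M (T ^^ i)) M T = distr \<mu> M (T ^^ Suc i)"
      using distr_distr[OF Tm Tn\<mu>] by (simp only: funpow.simps)
    then show ?case
      using push[OF Suc T] by (simp only:)
  qed
  then have \<nu>: "\<nu> j \<in> P" for j
    by (simp add: \<nu>_def)
  let ?W = "U_nbhd M T n \<nu> (1 / real n)"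
  have "openin (nbhd_topology M P) ?W"
    using T \<nu> \<open>n > 0\<close> by (intro openin_U_nbhd) auto
  moreover have "T \<in> ?W"
    using T \<open>n > 0\<close> by (simp add: U_nbhd_def E_set_def)
  moreover have "S \<notin> Ap M" if S: "S \<in> ?W" for S
  proof -
    have SA: "S \<in> Aut M"
      using S by (simp add: U_nbhd_def)
    let ?E = "E_set M S T"
    have E: "?E \<in> sets M"
      using E_set_in_sets[OF M SA T] .
    interpret prob_space \<mu> by fact
    \<comment> \<open>The points at which \<open>S\<close> and \<open>T\<close> disagree at step
      \<open>i\<close> of the \<open>T\<close>-orbit. Each \<open>F i\<close> with
      \<open>i < n\<close> has mass below \<open>1 / real n\<close>, so these sets together cannot
      cover a set of mass 1.\<close>
    define F where "F i = (T ^^ i) -` ?E \<inter> space \<mu>" for i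
    have Fsets: "F i \<in> events" for i
      unfolding F_def using Tn\<mu> E by (rule measurable_sets)
    have F: "prob (F i) < 1 / real n" if "i < n" for i
    proof -
      have "measure (\<nu> (Suc i)) ?E < 1 / real n"
        using S that unfolding U_nbhd_def by simp
      then show ?thesis
        unfolding \<nu>_def F_def using measure_distr[OF Tn\<mu> E] by simp
    qed
    have "prob (\<Union>i<n. F i) \<le> (\<Sum>i<n. prob (F i))"
      using Fsets by (intro finite_measure_subadditive_finite) auto
    also have "\<dots> < (\<Sum>i<n. 1 / real n)"
      using F \<open>n > 0\<close> by (intro sum_strict_mono) auto
    also have "\<dots> = 1"
      using \<open>n > 0\<close> by simp
    finally have "prob (\<Union>i<n. F i) < 1" .
    then have "\<not> {x \<in> space M. (T ^^ n) x = x} \<subseteq> (\<Union>i<n. F i)"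
      using \<mu>(2) finite_measure_mono[of "{x \<in> space M. (T ^^ n) x = x}" "\<Union>i<n. F i"] Fsets by force
    then obtain x where x: "x \<in> space M" "(T ^^ n) x = x" "\<And>i. i < n \<Longrightarrow> x \<notin> F i"
      by blast
    have "(S ^^ i) x = (T ^^ i) x" if "i \<le> n" for i
      using that
    proof (induction i)
      case (Suc i)
      have "(T ^^ i) x \<in> space M"
        using measurable_space[OF Tn x(1)] .
      moreover have "(T ^^ i) x \<notin> ?E"
        using x(3)[of i] Suc.prems x(1) \<mu>M(3) by (simp add: F_def)
      ultimately show ?case
        using Suc by (simp add: E_set_def)
    qed simp
    then have "(S ^^ n) x = x"
      using x(2) by simp
    then show "S \<notin> Ap M"
      using x(1) \<open>n > 0\<close> unfolding Ap_iff by blast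
  qed
  then have "?W \<inter> Ap M = {}"
    by blast
  ultimately show thesis
    by (rule that)
qed

section \<open>Countable modifications and approximating automorphisms\<close>

lemma Aut_modify_countable:
  assumes M: "standard_borel M" and T: "T \<in> Aut M" and S: "S permutes space M"
    and C: "countable C" "\<And>x. x \<in> space M \<Longrightarrow> x \<notin> C \<Longrightarrow> S x = T x"
  shows "S \<in> Aut M" and "E_set M S T \<subseteq> C \<union> T ` C"
proof -
  have T': "T permutes space M" "T \<in> M \<rightarrow>\<^sub>M M" "inv T \<in> M \<rightarrow>\<^sub>M M"
    using T by (auto simp: Aut_def)
  \<comment> \<open>Agreement of the maps off \<open>C\<close> gives agreement of the inverses off
    the image of \<open>C\<close> under \<open>T\<close>, which is why that image enters the
    bound.\<close>
  have inv: "inv S y = inv T y" if "y \<in> space M" "y \<notin> T ` C" for y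
  proof -
    have "inv T y \<notin> C"
      using that(2) permutes_inverses(1)[OF T'(1)] by (metis imageI)
    moreover have "inv T y \<in> space M"
      using that(1) permutes_in_image[OF permutes_inv[OF T'(1)]] by simp
    ultimately have "S (inv T y) = y"
      using C(2) permutes_inverses(1)[OF T'(1)] by simp
    then show ?thesis
      using permutes_inverses(2)[OF S] by metis
  qed
  show "E_set M S T \<subseteq> C \<union> T ` C"
    using C(2) inv unfolding E_set_def by fastforce
  \<comment> \<open>A change at countably many points preserves measurability because points are
    measurable; this is used for \<open>S\<close> and for its inverse.\<close>
  have *: "g \<in> M \<rightarrow>\<^sub>M M" if "f \<in> M \<rightarrow>\<^sub>M M" "countable D" "g permutes space M"
    "\<And>x. x \<in> space M \<Longrightarrow> x \<notin> D \<Longrightarrow> g x = f x" for f g D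
    using that permutes_in_image[OF that(3)]
    by (intro measurable_discrete_difference[of f M M "D \<inter> space M" g])
      (auto intro: singleton_in_sets[OF M])
  have "inv S \<in> M \<rightarrow>\<^sub>M M"
    by (rule *[OF T'(3) countable_image[OF C(1)] permutes_inv[OF S] inv])
  then show "S \<in> Aut M"
    unfolding Aut_def using *[OF T'(2) C(1) S C(2)] S by simp
qed

text \<open>\<open>C\<close> is identified with the integers and \<open>s\<close> becomes the shift
  by 1. On the integers, unlike the naturals, this shift is onto.\<close>

lemma aperiodic_permutation_of_countable:
  assumes "countable C" "infinite C"
  obtains s where "s permutes C" "\<And>x n. x \<in> C \<Longrightarrow> n > 0 \<Longrightarrow> (s ^^ n) x \<noteq> x"
proof -
  define b where "b = int_decode \<circ> to_nat_on C"
  have b: "bij_betw b C (UNIV :: int set)"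
    unfolding b_def using to_nat_on_infinite[OF assms] bij_int_decode by (rule bij_betw_trans)
  define s where "s x = (if x \<in> C then inv_into C b (b x + 1) else x)" for x
  have inC: "inv_into C b i \<in> C" and b_inv: "b (inv_into C b i) = i" for i
    using b by (auto simp: bij_betw_def inv_into_into f_inv_into_f)
  have bs: "s x \<in> C \<and> b (s x) = b x + 1" if "x \<in> C" for x
    using that inC b_inv by (simp add: s_def)
  have "s permutes C"
  proof (rule bij_imp_permutes)
    have "inj_on s C"
      using bs b by (metis add_right_cancel bij_betw_imp_inj_on inj_on_def)
    moreover have "s ` C = C"
    proof
      show "s ` C \<subseteq> C"
        using bs by blast
      show "C \<subseteq> s ` C"
      proof
        fix y assume y: "y \<in> C"
        have "s (inv_into C b (b y - 1)) = y"
          using y inC b_inv bij_betw_inv_into_left[OF b] by (simp add: s_def)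
        then show "y \<in> s ` C"
          using inC by (metis imageI)
      qed
    qed
    ultimately show "bij_betw s C C"
      by (simp add: bij_betw_def)
  qed (simp add: s_def)
  moreover have "(s ^^ n) x \<in> C \<and> b ((s ^^ n) x) = b x + int n" if "x \<in> C" for x n
    using that bs by (induction n) auto
  then have "(s ^^ n) x \<noteq> x" if "x \<in> C" "n > 0" for x n
    using that by (metis add_cancel_right_right less_irrefl of_nat_eq_0_iff)
  ultimately show thesis
    using that by blast
qed

lemma Ap_approximation:
  assumes M: "standard_borel M" "uncountable (space M)" and T: "T \<in> Ap_mod_Ctbl M"
  obtains S where "S \<in> Ap M" "countable (E_set M S T)"
proof (cases "periodic_points M T = {}")
  case True
  then have "T \<in> Ap M"
    using T unfolding Ap_iff Ap_mod_Ctbl_def periodic_points_def by blast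
  then show thesis
    using that[of T] by (simp add: E_set_def)
next
  case False
  define Q where "Q = periodic_points M T"
  have TA: "T \<in> Aut M" and Q: "countable Q"
    using T by (auto simp: Ap_mod_Ctbl_def Q_def)
  then have Tp: "T permutes space M"
    by (simp add: Aut_def)
  obtain x0 where x0: "x0 \<in> space M" "x0 \<notin> Q"
    using M(2) Q by (metis countable_subset subsetI)
  \<comment> \<open>The orbit of a point outside \<open>Q\<close> makes \<open>C\<close> infinite
    even when \<open>Q\<close> is finite; such a point exists because the space is
    uncountable.\<close>
  define C where "C = Q \<union> full_orbit T x0"
  have "countable C"
    unfolding C_def full_orbit_def using Q by auto
  have "infinite (full_orbit T x0)"
    using x0 finite_full_orbit_iff[OF permutes_bij[OF Tp]] unfolding Q_def periodic_points_def by blast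
  then have "infinite C"
    by (simp add: C_def)
  have T_in: "T y \<in> space M \<longleftrightarrow> y \<in> space M" "inv T y \<in> space M \<longleftrightarrow> y \<in> space M" for y
    using permutes_in_image[OF Tp] permutes_in_image[OF permutes_inv[OF Tp]] by auto
  have Tn_in: "(T ^^ n) x0 \<in> space M" "(inv T ^^ n) x0 \<in> space M" for n
    by (induction n) (use x0(1) T_in in auto)
  have CM: "C \<subseteq> space M"
    unfolding C_def Q_def periodic_points_def full_orbit_def using Tn_in by blast
  \<comment> \<open>Invariance of \<open>Q\<close> in both directions, together with that of the
    orbit, makes \<open>T\<close> a bijection of the complement of \<open>C\<close>, so that it can
    be glued to \<open>s\<close>.\<close>
  have TQ: "T y \<in> Q \<and> inv T y \<in> Q" if "y \<in> Q" for y
  proof -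
    obtain n where n: "n > 0" "(T ^^ n) y = y" "y \<in> space M"
      using \<open>y \<in> Q\<close> unfolding Q_def periodic_points_def by blast
    have "(T ^^ n) (T y) = T y"
      using n(2) by (simp flip: funpow_swap1)
    moreover have "T ((T ^^ n) (inv T y)) = y"
      using n(2) permutes_inverses(1)[OF Tp] by (simp add: funpow_swap1)
    then have "(T ^^ n) (inv T y) = inv T y"
      using permutes_inverses(2)[OF Tp] by metis
    ultimately show ?thesis
      unfolding Q_def periodic_points_def using T_in n by blast
  qed
  have TC: "T y \<in> C" and TC': "inv T y \<in> C" if "y \<in> C" for y
    using that TQ full_orbit_closed[OF permutes_bij[OF Tp], of y x0] unfolding C_def by blast+
  obtain s where s: "s permutes C" "\<And>x n. x \<in> C \<Longrightarrow> n > 0 \<Longrightarrow> (s ^^ n) x \<noteq> x"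
    using aperiodic_permutation_of_countable[OF \<open>countable C\<close> \<open>infinite C\<close>] by metis
  define S where "S x = (if x \<in> C then s x else T x)" for x
  have S_C: "S x \<in> C \<longleftrightarrow> x \<in> C" for x
    unfolding S_def using permutes_in_image[OF s(1)] TC' permutes_inverses(2)[OF Tp] by metis
  have "S permutes space M"
  proof (rule bij_imp_permutes)
    have "bij_betw S (C \<union> (space M - C)) (C \<union> (space M - C))"
    proof (rule bij_betw_combine)
      show "bij_betw S C C"
        using permutes_imp_bij[OF s(1)] by (rule bij_betw_cong[THEN iffD1, rotated]) (simp add: S_def)
      have "bij_betw T (space M - C) (space M - C)"
      proof (rule bij_betw_byWitness[where f' = "inv T"])
        show "T ` (space M - C) \<subseteq> space M - C"
          using T_in TC' permutes_inverses(2)[OF Tp] by (metis Diff_iff image_subsetI)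
        show "inv T ` (space M - C) \<subseteq> space M - C"
          using T_in TC permutes_inverses(1)[OF Tp] by (metis Diff_iff image_subsetI)
      qed (simp_all add: permutes_inverses[OF Tp])
      then show "bij_betw S (space M - C) (space M - C)"
        by (rule bij_betw_cong[THEN iffD1, rotated]) (simp add: S_def)
    qed blast
    moreover have "C \<union> (space M - C) = space M"
      using CM by blast
    ultimately show "bij_betw S (space M) (space M)"
      by simp
    show "S x = x" if "x \<notin> space M" for x
      using that CM permutes_not_in[OF Tp] by (auto simp: S_def)
  qed
  note S = Aut_modify_countable[OF M(1) TA this \<open>countable C\<close>]
  have "S \<in> Aut M" "E_set M S T \<subseteq> C \<union> T ` C"
    using S by (simp_all add: S_def)
  \<comment> \<open>Iterates of \<open>S\<close> never leave or enter \<open>C\<close>: inside they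
    are those of \<open>s\<close>, outside those of \<open>T\<close>, whose periodic points all lie
    in \<open>C\<close>.\<close>
  moreover have "(S ^^ n) x \<noteq> x" if x: "x \<in> space M" and "n > 0" for x n
  proof (cases "x \<in> C")
    case True
    then have "(S ^^ i) x \<in> C \<and> (S ^^ i) x = (s ^^ i) x" for i
      by (induction i) (auto simp: S_C, simp add: S_def)
    then show ?thesis
      using s(2)[OF True \<open>n > 0\<close>] by simp
  next
    case False
    then have "(S ^^ i) x \<notin> C \<and> (S ^^ i) x = (T ^^ i) x" for i
      by (induction i) (auto simp: S_C, simp add: S_def)
    moreover have "(T ^^ n) x \<noteq> x"
      using False x \<open>n > 0\<close> unfolding C_def Q_def periodic_points_def by blast
    ultimately show ?thesis
      by simp
  qed
  ultimately have "S \<in> Ap M"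
    unfolding Ap_iff by blast
  moreover have "countable (E_set M S T)"
    using \<open>E_set M S T \<subseteq> C \<union> T ` C\<close> \<open>countable C\<close> by (meson countable_Un countable_image countable_subset)
  ultimately show thesis
    using that by blast
qed

lemma not_Ap_approximation:
  assumes M: "standard_borel M" and T: "T \<in> Ap M" and "space M \<noteq> {}"
  obtains S where "\<And>k. S k \<in> Aut M - Ap M"
    "\<And>\<mu>. \<mu> \<in> prob_measures M \<Longrightarrow> (\<lambda>k. measure \<mu> (E_set M (S k) T)) \<longlonglongrightarrow> 0"
proof -
  obtain x where x: "x \<in> space M"
    using assms(3) by blast
  have TA: "T \<in> Aut M" and Tp: "T permutes space M"
    using T by (auto simp: Ap_iff Aut_def)
  define y where "y k = (T ^^ k) x" for k
  have y: "y k \<in> space M" for k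
    using x by (induction k) (auto simp: y_def permutes_in_image[OF Tp])
  have ySuc: "T (y k) = y (Suc k)" for k
    by (simp add: y_def)
  have "inj y"
  proof -
    have "y i \<noteq> y j" if "i < j" for i j
    proof
      assume "y i = y j"
      moreover have "(T ^^ (j - i)) (y i) = (T ^^ (j - i + i)) x"
        by (simp only: y_def funpow_add comp_apply)
      ultimately have "(T ^^ (j - i)) (y i) = y i"
        using that by (simp add: y_def)
      then show False
        using T y that unfolding Ap_iff by (metis zero_less_diff)
    qed
    then show ?thesis
      unfolding inj_def by (metis linorder_neqE_nat)
  qed
  \<comment> \<open>\<open>S k\<close> fixes \<open>y (Suc k)\<close> and sends \<open>y k\<close>
    past it to \<open>y (Suc (Suc k))\<close>; elsewhere it equals \<open>T\<close>. Hence the error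
    set has at most the three points \<open>y k\<close>, \<open>y (Suc k)\<close>,
    \<open>y (Suc (Suc k))\<close>.\<close>
  define S where "S k = Transposition.transpose (y (Suc k)) (y (Suc (Suc k))) \<circ> T" for k
  have "S k permutes space M" for k
    unfolding S_def using Tp y by (intro permutes_compose permutes_swap_id)
  moreover have "S k z = T z" if "z \<in> space M" "z \<notin> {y k, y (Suc k)}" for k z
  proof -
    have "T z \<noteq> y (Suc k)" "T z \<noteq> y (Suc (Suc k))"
      using that(2) ySuc permutes_inj[OF Tp] by (metis injD insertCI)+
    then show ?thesis
      by (simp add: S_def)
  qed
  ultimately have SA: "S k \<in> Aut M" and SE: "E_set M (S k) T \<subseteq> {y k, y (Suc k)} \<union> T ` {y k, y (Suc k)}" for k
    using Aut_modify_countable[OF M TA, of "S k" "{y k, y (Suc k)}"] by simp_all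
  have "(S k ^^ 1) (y (Suc k)) = y (Suc k)" for k
    by (simp add: S_def ySuc)
  then have "S k \<notin> Ap M" for k
    unfolding Ap_iff using y by (metis zero_less_one)
  moreover have "(\<lambda>k. measure \<mu> (E_set M (S k) T)) \<longlonglongrightarrow> 0" if "\<mu> \<in> prob_measures M" for \<mu>
  proof -
    have \<mu>: "prob_space \<mu>" "sets \<mu> = sets M"
      using that by (auto simp: prob_measures_def)
    interpret prob_space \<mu> by fact
    have ysets: "{y k} \<in> events" for k
      using singleton_in_sets[OF M y] \<mu>(2) by simp
    \<comment> \<open>The points are distinct, so their masses are summable and tend to 0. The same
      sequence \<open>S\<close> thus works for every \<open>\<mu>\<close>.\<close>
    have "(\<lambda>k. prob {y k}) sums prob (\<Union>k. {y k})"
      using ysets \<open>inj y\<close> by (intro finite_measure_UNION) (auto simp: disjoint_family_on_def inj_eq)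
    then have lim: "(\<lambda>k. prob {y k}) \<longlonglongrightarrow> 0"
      by (intro summable_LIMSEQ_zero sums_summable)
    have "(\<lambda>k. prob {y k} + (prob {y (Suc k)} + prob {y (Suc (Suc k))})) \<longlonglongrightarrow> 0 + (0 + 0)"
      by (intro tendsto_add lim LIMSEQ_Suc)
    then have lim3: "(\<lambda>k. prob {y k} + (prob {y (Suc k)} + prob {y (Suc (Suc k))})) \<longlonglongrightarrow> 0"
      by simp
    have "prob (E_set M (S k) T) \<le> prob {y k} + (prob {y (Suc k)} + prob {y (Suc (Suc k))})" for k
    proof -
      have "E_set M (S k) T \<subseteq> {y k} \<union> ({y (Suc k)} \<union> {y (Suc (Suc k))})"
        using SE[of k] ySuc by auto
      then have "prob (E_set M (S k) T) \<le> prob ({y k} \<union> ({y (Suc k)} \<union> {y (Suc (Suc k))}))"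
        using ysets by (intro finite_measure_mono sets.Un)
      also have "\<dots> \<le> prob {y k} + prob ({y (Suc k)} \<union> {y (Suc (Suc k))})"
        using ysets by (intro measure_Un_le sets.Un)
      also have "\<dots> \<le> prob {y k} + (prob {y (Suc k)} + prob {y (Suc (Suc k))})"
        using ysets by (intro add_left_mono measure_Un_le)
      finally show ?thesis .
    qed
    then show ?thesis
      by (intro Lim_null_comparison[OF _ lim3]) simp
  qed
  ultimately show thesis
    using that SA by blast
qed

section \<open>The closure of \<open>Ap M\<close> in \<open>tau0\<close> and its position in
  \<open>tau\<close>\<close>

theorem theorem2p11:
  fixes M :: "'a measure"
  assumes "standard_borel M" and "uncountable (space M)"
  shows "tau0 M closure_of Ap M = Ap_mod_Ctbl M \<and>
    nowhere_dense_in (tau M) (Ap M) \<and> closedin (tau M) (Ap M)"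
proof (intro conjI)
  note M = assms(1)
  have cp: "continuous_prob_measures M \<subseteq> prob_measures M"
    by (auto simp: continuous_prob_measures_def)
  \<comment> \<open>With one continuous measure neither class of measures is empty, so both
    topologies live on all of \<open>Aut M\<close>.\<close>
  obtain \<mu>0 where \<mu>0: "\<mu>0 \<in> continuous_prob_measures M"
    using continuous_prob_measure_exists[OF M sets.top assms(2)] by metis
  have top0: "topspace (tau0 M) = Aut M"
    unfolding tau0_def using \<mu>0 by (intro topspace_nbhd_topology) blast
  have top: "topspace (tau M) = Aut M"
    unfolding tau_def using \<mu>0 cp by (intro topspace_nbhd_topology) blast
  have per_sets: "{x \<in> space M. (T ^^ n) x = x} \<in> sets M" if "T \<in> Aut M" for T n
    using that by (intro sets_eq[OF M] measurable_compose_n) (auto simp: Aut_def)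

  show "tau0 M closure_of Ap M = Ap_mod_Ctbl M"
  proof (intro equalityI subsetI)
    fix T assume "T \<in> tau0 M closure_of Ap M"
    then have T: "T \<in> Aut M" and cl: "\<And>W. T \<in> W \<Longrightarrow> openin (tau0 M) W \<Longrightarrow> W \<inter> Ap M \<noteq> {}"
      unfolding in_closure_of top0 by blast+
    \<comment> \<open>An uncountable set of this kind would carry a continuous measure, and this
      would give \<open>T\<close> a \<open>tau0\<close>-neighbourhood free of aperiodic
      automorphisms.\<close>
    have "countable {x \<in> space M. (T ^^ n) x = x}" if "n > 0" for n
    proof (rule ccontr)
      assume unc: "uncountable {x \<in> space M. (T ^^ n) x = x}"
      obtain \<mu> where \<mu>: "\<mu> \<in> continuous_prob_measures M" "measure \<mu> {x \<in> space M. (T ^^ n) x = x} = 1"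
        by (rule continuous_prob_measure_exists[OF M per_sets[OF T] unc])
      obtain W where "openin (tau0 M) W" "T \<in> W" "W \<inter> Ap M = {}"
        by (rule periodic_nbhd_disjoint_Ap[OF M cp distr_Aut_continuous[OF _ _ M] T \<open>n > 0\<close> \<mu>, folded tau0_def])
      then show False
        using cl by blast
    qed
    then have "countable (\<Union>n\<in>{0<..}. {x \<in> space M. (T ^^ n) x = x})"
      by (intro countable_UN) auto
    moreover have "periodic_points M T = (\<Union>n\<in>{0<..}. {x \<in> space M. (T ^^ n) x = x})"
      unfolding periodic_points_def by auto
    ultimately show "T \<in> Ap_mod_Ctbl M"
      using T by (simp add: Ap_mod_Ctbl_def)
  next
    fix T assume T: "T \<in> Ap_mod_Ctbl M"
    then have TA: "T \<in> Aut M"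
      by (simp add: Ap_mod_Ctbl_def)
    obtain S where S: "S \<in> Ap M" "countable (E_set M S T)"
      by (rule Ap_approximation[OF assms T])
    have SA: "S \<in> Aut M"
      using S(1) by (simp add: Ap_def)
    have "measure \<mu> (E_set M S T) = 0" if "\<mu> \<in> continuous_prob_measures M" for \<mu>
    proof -
      have \<mu>: "prob_space \<mu>" "sets \<mu> = sets M" "\<And>x. x \<in> space M \<Longrightarrow> measure \<mu> {x} = 0"
        using that by (auto simp: continuous_prob_measures_def prob_measures_def)
      interpret prob_space \<mu> by fact
      have E: "E_set M S T \<subseteq> space M"
        by (auto simp: E_set_def)
      have "{x} \<in> null_sets \<mu>" if "x \<in> E_set M S T" for x
        using that E \<mu>(2,3) singleton_in_sets[OF M, of x]
        by (intro null_setsI) (auto simp: emeasure_eq_measure)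
      then have "(\<Union>x\<in>E_set M S T. {x}) \<in> null_sets \<mu>"
        using S(2) by (intro null_sets_UN')
      then show ?thesis
        by (simp add: measure_eq_0_null_sets)
    qed
    \<comment> \<open>The sequence criterion is applied to the constant sequence \<open>S\<close>,
      for which eventual membership is membership.\<close>
    then have "\<forall>\<^sub>F k :: nat in sequentially. S \<in> W" if "openin (tau0 M) W" "T \<in> W" for W
      using eventually_in_nbhd_topology[OF M cp SA TA _ that[unfolded tau0_def]] by simp
    then show "T \<in> tau0 M closure_of Ap M"
      unfolding in_closure_of top0 using TA S(1) by (auto simp: eventually_const_iff)
  qed

  show closed: "closedin (tau M) (Ap M)"
    unfolding closedin_def
  proof
    show "Ap M \<subseteq> topspace (tau M)"
      unfolding top Ap_def by blast
    have "\<exists>W. openin (tau M) W \<and> T \<in> W \<and> W \<subseteq> topspace (tau M) - Ap M"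
      if nT: "T \<in> topspace (tau M) - Ap M" for T
    proof -
      have T: "T \<in> Aut M"
        using nT top by simp
      have "T \<notin> Ap M"
        using nT by simp
      then obtain x n where x: "x \<in> space M" "n > 0" "(T ^^ n) x = x"
        using T unfolding Ap_iff by blast
      \<comment> \<open>The Dirac measure detects a single periodic point, where continuous measures
        need uncountably many.\<close>
      have ret: "return M x \<in> prob_measures M"
        using x(1) by (simp add: prob_measures_def prob_space_return)
      have meas: "measure (return M x) {x \<in> space M. (T ^^ n) x = x} = 1"
        using x per_sets[OF T, of n] by (simp add: measure_return)
      obtain W where "openin (tau M) W" "T \<in> W" "W \<inter> Ap M = {}"
        by (rule periodic_nbhd_disjoint_Ap[OF M subset_refl distr_Aut_prob T x(2) ret meas, folded tau_def])
      then show ?thesis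
        using openin_subset by blast
    qed
    then show "openin (tau M) (topspace (tau M) - Ap M)"
      by (subst openin_subopen) blast
  qed

  show "nowhere_dense_in (tau M) (Ap M)"
    unfolding nowhere_dense_in_def
  proof
    show "Ap M \<subseteq> topspace (tau M)"
      unfolding top Ap_def by blast
    \<comment> \<open>Since \<open>Ap M\<close> is closed, it is enough that its interior is empty.
      The interior is open, so around any of its points it would eventually contain the
      automorphisms \<open>S k\<close>, which are not aperiodic.\<close>
    have "T \<notin> tau M interior_of Ap M" for T
    proof
      assume int: "T \<in> tau M interior_of Ap M"
      then have T: "T \<in> Ap M"
        by (rule subsetD[OF interior_of_subset])
      then have TA: "T \<in> Aut M"
        by (simp add: Ap_def)
      have ne: "space M \<noteq> {}"
        using assms(2) by auto
      obtain S where S: "\<And>k. S k \<in> Aut M - Ap M"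
        "\<And>\<mu>. \<mu> \<in> prob_measures M \<Longrightarrow> (\<lambda>k. measure \<mu> (E_set M (S k) T)) \<longlonglongrightarrow> 0"
        by (rule not_Ap_approximation[OF M T ne]) (rule that)
      have "\<forall>\<^sub>F k in sequentially. S k \<in> tau M interior_of Ap M"
        using S(1) openin_interior_of int unfolding tau_def
        by (intro eventually_in_nbhd_topology[OF M subset_refl _ TA S(2)]) auto
      then obtain k where "S k \<in> tau M interior_of Ap M"
        unfolding eventually_sequentially by blast
      then have "S k \<in> Ap M"
        by (rule subsetD[OF interior_of_subset])
      then show False
        using S(1)[of k] by blast
    qed
    then show "tau M interior_of (tau M closure_of Ap M) = {}"
      unfolding closure_of_closedin[OF closed] by blast
  qed
qed

end
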